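(* Let $m$ be even and let $G^A$ be the graph of order $m$ constructed from a simple connected graph $G^B$ of order $m/2$ by adding a pendant vertex to each vertex of $G^B$. Let $A$ and $B$ be the adjacency matrices of $G^A$ and $G^B$, respectively. Then: i) $G^A$ is a signable negatively integrally invertible graph. ii) If $G^B$ is a bipartite graph, then $G^A$ is a signable positively integrally invertible bipartite graph. iii) $\Lambda^{pow}(G^A)=\sum_{\mu\in\sigma(B)}\sqrt{\mu^2+4}\ \ge\ \max\{\Lambda^{pow}(G^B),\,m\}$. iv) The graph $G^A$ is homothetically self-pseudoinvertible.
   Context: Adding a pendant vertex to each vertex of $G^B$ means: for each vertex $v$ of $G^B$ a new vertex $v'$ is added, joined by an edge to $v$ only (the corona graph). For a real symmetric matrix $A$, $A^\dagger$ denotes its Moore-Penrose inverse (equal to $A^{-1}$ when $A$ is invertible). $A^\dagger$ is called positively (negatively) signable if there exists a diagonal matrix $D$ with diagonal entries in $\{+1,-1\}$ (a signature matrix) such that all entries of $DA^\dagger D$ are non-negative (non-positive). A graph $G^A$ with adjacency matrix $A$ is signable pseudo-invertible if $A^\dagger$ is positively or negatively signable; in that case its pseudo-inverse graph $(G^A)^\dagger$ is the weighted graph with adjacency matrix $DA^\dagger D$ (if $A^\dagger$ is positively signable with signature matrix $D$), respectively $-DA^\dagger D$ (if $A^\dagger$ is negatively signable with signature matrix $D$). $G^A$ is positively (negatively) integrally invertible if $A$ is invertible, $A^{-1}$ has integer entries, and $A^{-1}$ is positively (negatively) signable. $\sigma(B)$ denotes the spectrum of $B$, with eigenvalues counted with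 multiplicity in sums. For a graph with adjacency matrix $A$ of order $m$ with eigenvalues $\lambda_1,\dots,\lambda_m$ (with multiplicity), $\Lambda^{pow}(G^A)=\sum_{k=1}^m|\lambda_k|$. A simple connected graph $G^A$ of order $m$ is homothetically self-pseudoinvertible if it is signable pseudo-invertible and there exist $\kappa\in\mathbb{R}$ and a permutation matrix $P$ of order $m$ such that $DA^\dagger D=\kappa PAP^T$, where $D$ is a signature matrix such that $DA^\dagger D$ (or $-DA^\dagger D$) is the adjacency matrix of the pseudo-inverse graph $(G^A)^\dagger$. *)

theory Defs
  imports
    "Graph_Theory.Graph_Theory"
    "Jordan_Normal_Form.Char_Poly"
    "HOL-Combinatorics.Permutations"
    Complex_Main
begin

section \<open>Graphs\<close>

text \<open>Simple graphs are the finite, loop-free, symmetric digraphs of locale \<open>pair_graph\<close>; an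
  undirected edge is represented by both of its orientations. The constant \<open>connected\<close> has to be
  qualified because of topological connectedness.\<close>

definition simple_connected_graph :: "'a pair_pre_digraph \<Rightarrow> bool" where
  "simple_connected_graph G \<longleftrightarrow> pair_graph G \<and> Digraph_Component.connected (with_proj G)"

definition bipartite_graph :: "'a pair_pre_digraph \<Rightarrow> bool" where
  "bipartite_graph G \<longleftrightarrow> pair_graph G \<and>
     (\<exists>X Y. pverts G = X \<union> Y \<and> X \<inter> Y = {} \<and> parcs G \<subseteq> (X \<times> Y) \<union> (Y \<times> X))"

text \<open>\<open>Inl v\<close> is the original vertex \<open>v\<close>, and \<open>Inr v\<close> is the new pendant vertex attached to it.\<close>

definition corona_graph :: "'a pair_pre_digraph \<Rightarrow> ('a + 'a) pair_pre_digraph" where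
  "corona_graph G = \<lparr>
     pverts = Inl ` pverts G \<union> Inr ` pverts G,
     parcs = {(Inl u, Inl v) |u v. (u, v) \<in> parcs G}
           \<union> {(Inl v, Inr v) |v. v \<in> pverts G}
           \<union> {(Inr v, Inl v) |v. v \<in> pverts G} \<rparr>"

text \<open>An adjacency matrix depends on an enumeration of the vertices; any enumeration is allowed.\<close>

definition adjacency_matrix_of :: "'a pair_pre_digraph \<Rightarrow> real mat \<Rightarrow> bool" where
  "adjacency_matrix_of G A \<longleftrightarrow> (\<exists>vs. distinct vs \<and> set vs = pverts G \<and>
     A = mat (length vs) (length vs) (\<lambda>(i, j). if (vs ! i, vs ! j) \<in> parcs G then 1 else 0))"

section \<open>Moore-Penrose inverse\<close>

definition is_moore_penrose_inverse :: "real mat \<Rightarrow> real mat \<Rightarrow> bool" where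
  "is_moore_penrose_inverse A X \<longleftrightarrow>
     X \<in> carrier_mat (dim_col A) (dim_row A) \<and>
     A * X * A = A \<and> X * A * X = X \<and>
     transpose_mat (A * X) = A * X \<and> transpose_mat (X * A) = X * A"

definition moore_penrose_inverse :: "real mat \<Rightarrow> real mat" where
  "moore_penrose_inverse A = (THE X. is_moore_penrose_inverse A X)"

lemma is_moore_penrose_inverse_unique:
  assumes "is_moore_penrose_inverse A X" and "is_moore_penrose_inverse A Y"
  shows "X = Y"
proof -
  define m n where "m = dim_row A" and "n = dim_col A"
  have A: "A \<in> carrier_mat m n" and X: "X \<in> carrier_mat n m" and Y: "Y \<in> carrier_mat n m"
    using assms by (auto simp: m_def n_def is_moore_penrose_inverse_def)
  note C = A X Y mult_carrier_mat[OF A X] mult_carrier_mat[OF A Y]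
    mult_carrier_mat[OF X A] mult_carrier_mat[OF Y A]
  have x: "A * X * A = A" "X * A * X = X" "transpose_mat (A * X) = A * X"
      "transpose_mat (X * A) = X * A"
    and y: "A * Y * A = A" "Y * A * Y = Y" "transpose_mat (A * Y) = A * Y"
      "transpose_mat (Y * A) = Y * A"
    using assms by (auto simp: is_moore_penrose_inverse_def)
  have "(A * Y) * (A * X) = A * X"
    using assoc_mult_mat[OF C(5) A X] y(1) by simp
  then have "transpose_mat ((A * Y) * (A * X)) = A * X"
    using x(3) by simp
  then have "(A * X) * (A * Y) = A * X"
    using transpose_mult[OF C(5) C(4)] x(3) y(3) by simp
  moreover have "(A * X) * (A * Y) = A * Y"
    using assoc_mult_mat[OF C(4) A Y] x(1) by simp
  ultimately have AX: "A * X = A * Y" by simp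
  have "(X * A) * (Y * A) = X * A"
    using assoc_mult_mat[OF X A C(7)] assoc_mult_mat[OF A Y A] y(1) by simp
  then have "transpose_mat ((X * A) * (Y * A)) = X * A"
    using x(4) by simp
  then have "(Y * A) * (X * A) = X * A"
    using transpose_mult[OF C(6) C(7)] x(4) y(4) by simp
  moreover have "(Y * A) * (X * A) = Y * A"
    using assoc_mult_mat[OF Y A C(6)] assoc_mult_mat[OF A X A] x(1) by simp
  ultimately have XA: "X * A = Y * A" by simp
  have "X = Y * A * X" using x(2) XA by simp
  also have "\<dots> = Y * (A * Y)" using assoc_mult_mat[OF Y A X] AX by simp
  also have "\<dots> = Y" using assoc_mult_mat[OF Y A Y] y(2) by simp
  finally show ?thesis .
qed

lemma moore_penrose_inverse_eq_inverse:
  assumes A: "A \<in> carrier_mat n n" and X: "X \<in> carrier_mat n n"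
    and inv: "inverts_mat A X" "inverts_mat X A"
  shows "moore_penrose_inverse A = X"
proof -
  have "is_moore_penrose_inverse A X"
    using assms by (auto simp: is_moore_penrose_inverse_def inverts_mat_def)
  then show ?thesis
    unfolding moore_penrose_inverse_def
    using is_moore_penrose_inverse_unique by blast
qed

section \<open>Signability and pseudo-inverse graphs\<close>

definition signature_matrix :: "nat \<Rightarrow> real mat \<Rightarrow> bool" where
  "signature_matrix n D \<longleftrightarrow> D \<in> carrier_mat n n \<and> diagonal_mat D \<and>
     (\<forall>i<n. D $$ (i, i) \<in> {1, -1})"

definition nonnegative_matrix :: "real mat \<Rightarrow> bool" where
  "nonnegative_matrix M \<longleftrightarrow> (\<forall>x\<in>elements_mat M. 0 \<le> x)"

definition nonpositive_matrix :: "real mat \<Rightarrow> bool" where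
  "nonpositive_matrix M \<longleftrightarrow> (\<forall>x\<in>elements_mat M. x \<le> 0)"

definition positively_signable :: "real mat \<Rightarrow> bool" where
  "positively_signable M \<longleftrightarrow>
     (\<exists>D. signature_matrix (dim_row M) D \<and> nonnegative_matrix (D * M * D))"

definition negatively_signable :: "real mat \<Rightarrow> bool" where
  "negatively_signable M \<longleftrightarrow>
     (\<exists>D. signature_matrix (dim_row M) D \<and> nonpositive_matrix (D * M * D))"

text \<open>The following properties of a graph are expressed through its adjacency matrix \<open>A\<close>.
  All of them are invariant under a change of the vertex enumeration.\<close>

definition signable_pseudo_invertible :: "real mat \<Rightarrow> bool" where
  "signable_pseudo_invertible A \<longleftrightarrow>
     positively_signable (moore_penrose_inverse A) \<or> negatively_signable (moore_penrose_inverse A)"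

definition positively_integrally_invertible :: "real mat \<Rightarrow> bool" where
  "positively_integrally_invertible A \<longleftrightarrow>
     (\<exists>X \<in> carrier_mat (dim_row A) (dim_row A). square_mat A \<and>
        inverts_mat A X \<and> inverts_mat X A \<and> elements_mat X \<subseteq> \<int> \<and> positively_signable X)"

definition negatively_integrally_invertible :: "real mat \<Rightarrow> bool" where
  "negatively_integrally_invertible A \<longleftrightarrow>
     (\<exists>X \<in> carrier_mat (dim_row A) (dim_row A). square_mat A \<and>
        inverts_mat A X \<and> inverts_mat X A \<and> elements_mat X \<subseteq> \<int> \<and> negatively_signable X)"

text \<open>The weighted pseudo-inverse graph is identified with its weighted adjacency matrix \<open>W\<close>; it
  is a relation because \<open>W\<close> depends on the chosen signature matrix \<open>D\<close>.\<close>

definition pseudo_inverse_graph :: "real mat \<Rightarrow> real mat \<Rightarrow> real mat \<Rightarrow> bool" where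
  "pseudo_inverse_graph A D W \<longleftrightarrow>
     signature_matrix (dim_row A) D \<and>
     (let N = D * moore_penrose_inverse A * D in
        nonnegative_matrix N \<and> W = N \<or> nonpositive_matrix N \<and> W = - N)"

definition permutation_matrix :: "nat \<Rightarrow> real mat \<Rightarrow> bool" where
  "permutation_matrix n P \<longleftrightarrow>
     (\<exists>p. p permutes {..<n} \<and> P = mat n n (\<lambda>(i, j). if i = p j then 1 else 0))"

definition homothetically_self_pseudoinvertible ::
  "'a pair_pre_digraph \<Rightarrow> real mat \<Rightarrow> bool" where
  "homothetically_self_pseudoinvertible G A \<longleftrightarrow>
     simple_connected_graph G \<and> adjacency_matrix_of G A \<and> signable_pseudo_invertible A \<and>
     (\<exists>D W. pseudo_inverse_graph A D W \<and>
        (\<exists>\<kappa> P. permutation_matrix (dim_row A) P \<and>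
           D * moore_penrose_inverse A * D = \<kappa> \<cdot>\<^sub>m (P * A * transpose_mat P)))"

section \<open>Spectrum\<close>

text \<open>Multiset of eigenvalues with algebraic multiplicity. Only real roots of the characteristic
  polynomial are collected, which loses nothing for symmetric real matrices.\<close>

definition spectrum_mset :: "real mat \<Rightarrow> real multiset" where
  "spectrum_mset A = proots (char_poly A)"

definition Lambda_pow :: "real mat \<Rightarrow> real" where
  "Lambda_pow A = (\<Sum>x\<in>#spectrum_mset A. \<bar>x\<bar>)"

end

theory Submission
  imports Defs
begin

text \<open>Write \<open>A\<close> in blocks according to original and pendant vertices, \<open>A = (B, 1; 1, 0)\<close>. Its inverse is
\<open>(0, 1; 1, -B)\<close>, which is \<open>A\<close> again after exchanging every vertex with its pendant and multiplying
the entries by signs: \<open>X x y = - \<sigma> x * A (swap x) (swap y) * \<sigma> y\<close>, where \<open>\<sigma>\<close> is \<open>1\<close> on original and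
\<open>-1\<close> on pendant vertices. Conjugating the inverse by the signature \<open>\<sigma>\<close> therefore gives \<open>- P A P\<^sup>T\<close> for
the permutation matrix \<open>P\<close> of the swap (\<open>sign_conjugate_corona_inverse\<close>). This single identity yields
negative signability and homothetic self-pseudoinvertibility with factor \<open>-1\<close>. If \<open>G\<^sup>B\<close> is
bipartite, the signature that is constant on each original vertex together with its pendant, and
given by the bipartition, removes the sign of \<open>-B\<close> and keeps the identity blocks
(\<open>positively_signable_corona_inverse\<close>).

For the spectrum, eliminating the pendant block gives \<open>\<chi>\<^sub>A(x) = x\<^sup>n \<chi>\<^sub>B(x - 1/x)\<close> for \<open>x \<noteq> 0\<close>
(\<open>poly_char_poly_corona_block\<close>). Since \<open>B\<close> is symmetric, \<open>\<chi>\<^sub>B\<close> splits over the reals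
(\<open>char_poly_real_symmetric_splits\<close>), so each eigenvalue \<open>\<mu>\<close> of \<open>B\<close> contributes to \<open>\<chi>\<^sub>A\<close> the factor
\<open>x\<^sup>2 - \<mu> x - 1\<close>. Its two roots have product \<open>-1\<close>, so they have opposite signs and the sum of
their absolute values is their distance \<open>sqrt (\<mu>\<^sup>2 + 4)\<close>. The lower bounds hold summand by summand,
because \<open>sqrt (\<mu>\<^sup>2 + 4)\<close> is at least \<open>\<bar>\<mu>\<bar>\<close> and at least \<open>2\<close>, and there are \<open>m / 2\<close> eigenvalues.\<close>

section \<open>Matrices indexed by vertices\<close>

text \<open>Matrices are handled through functions on vertices, relative to a duplicate-free enumeration. All
identities below then become identities between such functions, in which the enumeration no longer
occurs.\<close>
definition indexed_mat :: "'a list \<Rightarrow> 'b list \<Rightarrow> ('a \<Rightarrow> 'b \<Rightarrow> 'c) \<Rightarrow> 'c mat" where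
  "indexed_mat us vs f = mat (length us) (length vs) (\<lambda>(i, j). f (us ! i) (vs ! j))"

lemma indexed_mat_carrier [simp, intro]: "indexed_mat us vs f \<in> carrier_mat (length us) (length vs)"
  and dim_row_indexed_mat [simp]: "dim_row (indexed_mat us vs f) = length us"
  and dim_col_indexed_mat [simp]: "dim_col (indexed_mat us vs f) = length vs"
  by (simp_all add: indexed_mat_def)

lemma indexed_mat_cong:
  assumes "\<And>u v. u \<in> set us \<Longrightarrow> v \<in> set vs \<Longrightarrow> f u v = g u v"
  shows "indexed_mat us vs f = indexed_mat us vs g"
  by (rule eq_matI) (auto simp: indexed_mat_def assms)

lemma transpose_indexed_mat: "transpose_mat (indexed_mat us vs f) = indexed_mat vs us (\<lambda>v u. f u v)"
  by (rule eq_matI) (auto simp: indexed_mat_def)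

lemma ball_elements_indexed_mat:
  assumes "\<And>u v. u \<in> set us \<Longrightarrow> v \<in> set vs \<Longrightarrow> Q (f u v)"
  shows "\<forall>x\<in>elements_mat (indexed_mat us vs f). Q x"
  by (auto dest!: elements_matD simp: indexed_mat_def assms)

lemma indexed_mat_eq_one: "distinct vs \<Longrightarrow> indexed_mat vs vs (\<lambda>u v. of_bool (u = v)) = 1\<^sub>m (length vs)"
  by (rule eq_matI) (auto simp: indexed_mat_def nth_eq_iff_index_eq)

lemma indexed_mat_mult:
  fixes f :: "'a \<Rightarrow> 'b \<Rightarrow> 'c :: semiring_0"
  assumes "distinct vs"
  shows "indexed_mat us vs f * indexed_mat vs ws g
       = indexed_mat us ws (\<lambda>u w. \<Sum>v\<in>set vs. f u v * g v w)"
proof (rule eq_matI)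
  fix i j assume *: "i < dim_row (indexed_mat us ws (\<lambda>u w. \<Sum>v\<in>set vs. f u v * g v w))"
    "j < dim_col (indexed_mat us ws (\<lambda>u w. \<Sum>v\<in>set vs. f u v * g v w))"
  have "(\<Sum>v\<in>set vs. f (us ! i) v * g v (ws ! j)) = (\<Sum>k = 0..<length vs. f (us ! i) (vs ! k) * g (vs ! k) (ws ! j))"
    using assms by (intro sum.reindex_bij_betw[symmetric] bij_betw_nth) auto
  with * show "(indexed_mat us vs f * indexed_mat vs ws g) $$ (i, j)
      = indexed_mat us ws (\<lambda>u w. \<Sum>v\<in>set vs. f u v * g v w) $$ (i, j)"
    by (simp add: indexed_mat_def scalar_prod_def)
qed auto

text \<open>Indicator factors are turned into conditionals, so that a sum over vertices collapses to the single
vertex that the indicator selects.\<close>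
lemmas delta_simps = of_bool_def if_distrib[where f = uminus]
  if_distrib[where f = "\<lambda>x. x * c" for c] if_distrib[where f = "\<lambda>x. c * x" for c]

lemma diagonal_conjugate_indexed_mat:
  fixes f :: "'a \<Rightarrow> 'a \<Rightarrow> 'c :: semiring_1" and s :: "'a \<Rightarrow> 'c"
  assumes "distinct vs"
  defines "D \<equiv> indexed_mat vs vs (\<lambda>u v. s u * of_bool (u = v))"
  shows "D * indexed_mat vs vs f * D = indexed_mat vs vs (\<lambda>u v. s u * f u v * s v)"
  unfolding D_def using assms(1)
  by (simp add: indexed_mat_mult) (rule indexed_mat_cong; simp add: delta_simps cong: if_cong)

text \<open>Re-enumerating the vertices conjugates the matrix by the permutation matrix that translates one
enumeration into the other; its inverse translates back.\<close>
lemma similar_indexed_mat: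
  fixes f :: "'a \<Rightarrow> 'a \<Rightarrow> 'c :: semiring_1"
  assumes us: "distinct us" and vs: "distinct vs" and eq: "set us = set vs"
  shows "similar_mat (indexed_mat us us f) (indexed_mat vs vs f)"
proof (rule similar_matI)
  let ?P = "indexed_mat us vs (\<lambda>u v. of_bool (u = v)) :: 'c mat"
  let ?Q = "indexed_mat vs us (\<lambda>u v. of_bool (u = v)) :: 'c mat"
  have len: "length us = length vs"
    using assms by (metis distinct_card)
  show "{indexed_mat us us f, indexed_mat vs vs f, ?P, ?Q} \<subseteq> carrier_mat (length us) (length us)"
    by (auto simp: len simp flip: carrier_mat_def)
  have "?P * ?Q = indexed_mat us us (\<lambda>u v. of_bool (u = v))"
    unfolding indexed_mat_mult[OF vs] by (rule indexed_mat_cong) (simp add: delta_simps eq cong: if_cong)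
  then show "?P * ?Q = 1\<^sub>m (length us)" by (simp add: indexed_mat_eq_one us)
  have "?Q * ?P = indexed_mat vs vs (\<lambda>u v. of_bool (u = v))"
    unfolding indexed_mat_mult[OF us] by (rule indexed_mat_cong) (simp add: delta_simps eq cong: if_cong)
  then show "?Q * ?P = 1\<^sub>m (length us)" by (simp add: indexed_mat_eq_one vs len)
  show "indexed_mat us us f = ?P * indexed_mat vs vs f * ?Q"
    unfolding indexed_mat_mult[OF vs]
    by (rule indexed_mat_cong) (simp add: delta_simps eq cong: if_cong)
qed

lemma indexed_mat_append:
  "indexed_mat (us1 @ us2) (vs1 @ vs2) f
   = four_block_mat (indexed_mat us1 vs1 f) (indexed_mat us1 vs2 f)
       (indexed_mat us2 vs1 f) (indexed_mat us2 vs2 f)"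
  by (rule eq_matI) (auto simp: indexed_mat_def nth_append)

lemma indexed_mat_map: "indexed_mat (map g us) (map h vs) f = indexed_mat us vs (\<lambda>u v. f (g u) (h v))"
  by (rule eq_matI) (auto simp: indexed_mat_def)

text \<open>A permutation \<open>\<pi>\<close> of the vertices becomes a permutation of the positions \<open>{..<n}\<close> by transport
along the enumeration.\<close>
lemma permutation_matrix_indexed_mat:
  assumes vs: "distinct vs" and bij: "bij_betw \<pi> (set vs) (set vs)"
  shows "permutation_matrix (length vs) (indexed_mat vs vs (\<lambda>u v. of_bool (u = \<pi> v)))"
proof -
  let ?n = "length vs"
  have nth: "bij_betw ((!) vs) {..<?n} (set vs)"
    using vs by (rule bij_betw_nth) auto
  define pos where "pos = the_inv_into {..<?n} ((!) vs)"
  have pos: "bij_betw pos (set vs) {..<?n}"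
    unfolding pos_def by (rule bij_betw_the_inv_into[OF nth])
  have nth_pos: "vs ! pos v = v" if "v \<in> set vs" for v
    unfolding pos_def using nth that by (auto simp: bij_betw_def intro: f_the_inv_into_f)
  define p where "p = (\<lambda>j. if j < ?n then pos (\<pi> (vs ! j)) else j)"
  have "bij_betw (pos \<circ> (\<pi> \<circ> (!) vs)) {..<?n} {..<?n}"
    using nth bij pos by (blast intro: bij_betw_trans)
  then have "bij_betw p {..<?n} {..<?n}"
    by (rule iffD1[OF bij_betw_cong, rotated]) (auto simp: p_def)
  then have "p permutes {..<?n}"
    by (rule bij_imp_permutes) (auto simp: p_def)
  moreover have "vs ! i = \<pi> (vs ! j) \<longleftrightarrow> i = p j" if "i < ?n" "j < ?n" for i j
  proof -
    have \<pi>: "\<pi> (vs ! j) \<in> set vs"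
      using bij that by (auto simp: bij_betw_def)
    have "p j < ?n" using pos \<pi> that by (auto simp: p_def bij_betw_def)
    moreover have "\<pi> (vs ! j) = vs ! p j" using nth_pos[OF \<pi>] that by (simp add: p_def)
    ultimately show ?thesis
      using that by (simp add: nth_eq_iff_index_eq[OF vs])
  qed
  ultimately show ?thesis
    unfolding permutation_matrix_def
    by (intro exI[of _ p] conjI eq_matI) (auto simp: indexed_mat_def)
qed

lemma signature_matrix_indexed_mat:
  assumes "distinct vs" and "\<And>v. v \<in> set vs \<Longrightarrow> s v \<in> {1, - 1}"
  shows "signature_matrix (length vs) (indexed_mat vs vs (\<lambda>u v. s u * of_bool (u = v)))"
  using assms by (auto simp: signature_matrix_def diagonal_mat_def indexed_mat_def nth_eq_iff_index_eq)

section \<open>Adjacency in the corona graph\<close>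

definition arc_weight :: "'a pair_pre_digraph \<Rightarrow> 'a \<Rightarrow> 'a \<Rightarrow> real" where
  "arc_weight G u v = of_bool ((u, v) \<in> parcs G)"

lemma adjacency_matrix_ofE:
  assumes "adjacency_matrix_of G A"
  obtains vs where "distinct vs" "set vs = pverts G" "A = indexed_mat vs vs (arc_weight G)"
  using assms by (auto simp: adjacency_matrix_of_def indexed_mat_def arc_weight_def of_bool_def)

lemma pair_graph_arc_sym:
  assumes "pair_graph G"
  shows "(u, v) \<in> parcs G \<longleftrightarrow> (v, u) \<in> parcs G"
proof -
  interpret pair_graph G by fact
  have "sym (parcs G)" using sym_arcs by (simp add: symmetric_def)
  then show ?thesis by (blast dest: symD)
qed

lemma adjacency_matrix_symmetric:
  assumes "pair_graph G"
  shows "transpose_mat (indexed_mat vs vs (arc_weight G)) = indexed_mat vs vs (arc_weight G)"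
  using pair_graph_arc_sym[OF assms]
  by (simp add: transpose_indexed_mat) (rule indexed_mat_cong; simp add: arc_weight_def)

lemma pverts_corona_graph: "pverts (corona_graph G) = Inl ` pverts G \<union> Inr ` pverts G"
  by (simp add: corona_graph_def)

lemma arc_weight_corona [simp]:
  "arc_weight (corona_graph G) (Inl u) (Inl v) = arc_weight G u v"
  "v \<in> pverts G \<Longrightarrow> arc_weight (corona_graph G) (Inl u) (Inr v) = of_bool (u = v)"
  "v \<in> pverts G \<Longrightarrow> arc_weight (corona_graph G) (Inr u) (Inl v) = of_bool (u = v)"
  "arc_weight (corona_graph G) (Inr u) (Inr v) = 0"
  by (auto simp: arc_weight_def corona_graph_def)

lemma sum_corona_verts:
  assumes "finite (pverts G)"
  shows "sum f (pverts (corona_graph G)) = (\<Sum>v\<in>pverts G. f (Inl v)) + (\<Sum>v\<in>pverts G. f (Inr v))"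
  unfolding pverts_corona_graph using assms
  by (subst sum.union_disjoint) (auto simp: sum.reindex)

lemma pair_graph_corona:
  assumes "pair_graph G"
  shows "pair_graph (corona_graph G)"
proof -
  let ?H = "corona_graph G"
  interpret pair_graph G by fact
  have sub: "parcs ?H \<subseteq> pverts ?H \<times> pverts ?H"
    using wellformed' by (auto simp: corona_graph_def)
  have fin: "finite (pverts ?H)"
    by (simp add: pverts_corona_graph)
  have "sym (parcs ?H)"
    using pair_graph_arc_sym[OF assms] by (intro symI) (auto simp: corona_graph_def)
  then have sym: "symmetric (with_proj ?H)"
    by (simp add: symmetric_def)
  show ?thesis
  proof unfold_locales
    show "finite (parcs ?H)"
      using sub fin by (meson finite_SigmaI finite_subset)
    show "fst e \<noteq> snd e" if "e \<in> parcs ?H" for e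
      using that no_loops by (auto simp: corona_graph_def)
  qed (use sub fin sym in auto)
qed

lemma connected_pair_graph_iff:
  assumes "pair_graph G"
  shows "Digraph_Component.connected (with_proj G) \<longleftrightarrow>
    pverts G \<noteq> {} \<and> (\<forall>u\<in>pverts G. \<forall>v\<in>pverts G. u \<rightarrow>\<^sup>*\<^bsub>with_proj G\<^esub> v)"
proof -
  interpret pair_graph G by fact
  have "verts (with_proj (mk_symmetric (with_proj G))) = pverts G"
    by (simp add: mk_symmetric_def)
  then show ?thesis
    unfolding connected_def strongly_connected_def
    by (simp only: reachable_mk_symmetric_eq[OF pair_sym_arcs])
qed

text \<open>Every vertex reaches the original vertex that it belongs to in at most one step, and walks of \<open>G\<close>
persist among the original vertices. Reachability in the other direction comes from symmetry.\<close>
lemma connected_corona: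
  assumes "pair_graph G" and "Digraph_Component.connected (with_proj G)"
  shows "Digraph_Component.connected (with_proj (corona_graph G))"
proof -
  let ?H = "corona_graph G"
  interpret G: pair_graph G by fact
  interpret H: pair_graph ?H using assms(1) by (rule pair_graph_corona)
  have G_conn: "u \<rightarrow>\<^sup>*\<^bsub>with_proj G\<^esub> v" if "u \<in> pverts G" "v \<in> pverts G" for u v
    using assms(2) that by (simp add: connected_pair_graph_iff[OF assms(1)])
  have lift: "Inl u \<rightarrow>\<^sup>*\<^bsub>with_proj ?H\<^esub> Inl v" if "u \<rightarrow>\<^sup>*\<^bsub>with_proj G\<^esub> v" for u v
    using that
  proof (induction rule: G.reachable_induct)
    case base
    then show ?case by (simp add: pverts_corona_graph)
  next
    case (step v w)
    then have "(Inl v, Inl w) \<in> parcs ?H" by (simp add: corona_graph_def)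
    with step.IH show ?case by (rule H.reachable_adj_trans)
  qed
  have down: "x \<rightarrow>\<^sup>*\<^bsub>with_proj ?H\<^esub> Inl (case_sum id id x)" if "x \<in> pverts ?H" for x
  proof (cases x)
    case (Inl u)
    then show ?thesis using that by simp
  next
    case (Inr u)
    then have "(x, Inl u) \<in> parcs ?H" using that by (auto simp: corona_graph_def)
    then have "x \<rightarrow>\<^sup>*\<^bsub>with_proj ?H\<^esub> Inl u" by (rule H.reachable_adjI)
    then show ?thesis using Inr by simp
  qed
  have "x \<rightarrow>\<^sup>*\<^bsub>with_proj ?H\<^esub> y" if x: "x \<in> pverts ?H" and y: "y \<in> pverts ?H" for x y
  proof -
    have "case_sum id id x \<in> pverts G" "case_sum id id y \<in> pverts G"
      using x y by (auto simp: pverts_corona_graph)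
    then show ?thesis
      using down[OF x] lift[OF G_conn] H.symmetric_reachable'[OF down[OF y]]
      by (meson H.reachable_trans)
  qed
  moreover have "pverts ?H \<noteq> {}"
    using assms(2) by (simp add: connected_pair_graph_iff[OF assms(1)] pverts_corona_graph)
  ultimately show ?thesis
    by (simp add: connected_pair_graph_iff[OF H.pair_graph_axioms])
qed

text \<open>A pendant vertex goes to the side of the bipartition opposite to its original vertex.\<close>
lemma bipartite_corona:
  assumes "bipartite_graph G"
  shows "bipartite_graph (corona_graph G)"
proof -
  obtain Y Z where YZ: "pverts G = Y \<union> Z" "Y \<inter> Z = {}" "parcs G \<subseteq> (Y \<times> Z) \<union> (Z \<times> Y)"
    and G: "pair_graph G"
    using assms by (auto simp: bipartite_graph_def)
  have "pverts (corona_graph G) = (Inl ` Y \<union> Inr ` Z) \<union> (Inl ` Z \<union> Inr ` Y)"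
    using YZ(1) by (auto simp: pverts_corona_graph)
  moreover have "(Inl ` Y \<union> Inr ` Z) \<inter> (Inl ` Z \<union> Inr ` Y) = {}"
    using YZ(2) by auto
  moreover have "parcs (corona_graph G) \<subseteq> (Inl ` Y \<union> Inr ` Z) \<times> (Inl ` Z \<union> Inr ` Y)
      \<union> (Inl ` Z \<union> Inr ` Y) \<times> (Inl ` Y \<union> Inr ` Z)"
    using YZ by (auto simp: corona_graph_def)
  ultimately show ?thesis
    using pair_graph_corona[OF G] unfolding bipartite_graph_def by blast
qed

section \<open>The signed inverse of the corona\<close>

fun corona_swap :: "'a + 'a \<Rightarrow> 'a + 'a" where
  "corona_swap (Inl v) = Inr v" | "corona_swap (Inr v) = Inl v"

fun corona_sign :: "'a + 'a \<Rightarrow> real" where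
  "corona_sign (Inl v) = 1" | "corona_sign (Inr v) = - 1"

text \<open>These are the entries of \<open>(0, 1; 1, -B)\<close>. Writing them as a signed, swapped copy of the adjacency
matrix makes the conjugation by the signature \<open>corona_sign\<close> transparent.\<close>
definition corona_inverse_weight :: "'a pair_pre_digraph \<Rightarrow> 'a + 'a \<Rightarrow> 'a + 'a \<Rightarrow> real" where
  "corona_inverse_weight G x y =
     - (corona_sign x * arc_weight (corona_graph G) (corona_swap x) (corona_swap y) * corona_sign y)"

lemma corona_inverse_weight [simp]:
  "corona_inverse_weight G (Inl u) (Inl v) = 0"
  "v \<in> pverts G \<Longrightarrow> corona_inverse_weight G (Inl u) (Inr v) = of_bool (u = v)"
  "v \<in> pverts G \<Longrightarrow> corona_inverse_weight G (Inr u) (Inl v) = of_bool (u = v)"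
  "corona_inverse_weight G (Inr u) (Inr v) = - arc_weight G u v"
  by (simp_all add: corona_inverse_weight_def)

text \<open>Splitting the sum over the vertices of the corona into original and pendant vertices is the block
multiplication \<open>(B, 1; 1, 0) (0, 1; 1, -B) = 1\<close>; in the upper right block \<open>B\<close> and \<open>-B\<close> cancel.\<close>
lemma corona_inverse:
  fixes G :: "'a pair_pre_digraph"
  assumes fin: "finite (pverts G)" and vs: "distinct vs" "set vs = pverts (corona_graph G)"
  defines "A \<equiv> indexed_mat vs vs (arc_weight (corona_graph G))"
    and "X \<equiv> indexed_mat vs vs (corona_inverse_weight G)"
  shows "A * X = 1\<^sub>m (length vs)" "X * A = 1\<^sub>m (length vs)"
proof -
  have "A * X = indexed_mat vs vs (\<lambda>u v. of_bool (u = v))"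
    unfolding A_def X_def indexed_mat_mult[OF vs(1)] vs(2) sum_corona_verts[OF fin]
    by (rule indexed_mat_cong)
       (auto simp: vs(2) pverts_corona_graph fin delta_simps sum_negf cong: if_cong split: if_splits)
  then show "A * X = 1\<^sub>m (length vs)" by (simp add: indexed_mat_eq_one vs)
  have "X * A = indexed_mat vs vs (\<lambda>u v. of_bool (u = v))"
    unfolding A_def X_def indexed_mat_mult[OF vs(1)] vs(2) sum_corona_verts[OF fin]
    by (rule indexed_mat_cong)
       (auto simp: vs(2) pverts_corona_graph fin delta_simps sum_negf cong: if_cong split: if_splits)
  then show "X * A = 1\<^sub>m (length vs)" by (simp add: indexed_mat_eq_one vs)
qed

context
  fixes G :: "'a pair_pre_digraph" and vs :: "('a + 'a) list" and A X :: "real mat"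
  assumes fin: "finite (pverts G)" and vs: "distinct vs" "set vs = pverts (corona_graph G)"
  defines "A \<equiv> indexed_mat vs vs (arc_weight (corona_graph G))"
    and "X \<equiv> indexed_mat vs vs (corona_inverse_weight G)"
begin

lemma moore_penrose_inverse_corona: "moore_penrose_inverse A = X"
  using corona_inverse[OF fin vs] unfolding A_def X_def
  by (intro moore_penrose_inverse_eq_inverse[of _ "length vs"]) (auto simp: inverts_mat_def)

lemma corona_inverse_integral: "elements_mat X \<subseteq> \<int>"
proof -
  have "corona_inverse_weight G u v \<in> \<int>" for u v
    by (cases u; cases v) (auto simp: corona_inverse_weight_def arc_weight_def)
  then show ?thesis
    unfolding X_def subset_eq by (rule ball_elements_indexed_mat)
qed

lemma integral_inverse_corona:
  "X \<in> carrier_mat (dim_row A) (dim_row A) \<and> square_mat A \<and>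
     inverts_mat A X \<and> inverts_mat X A \<and> elements_mat X \<subseteq> \<int>"
  using corona_inverse[OF fin vs] corona_inverse_integral unfolding A_def X_def
  by (auto simp: inverts_mat_def)

text \<open>The two signs in \<open>D X D\<close> square away against those in the definition of \<open>corona_inverse_weight\<close>,
which leaves \<open>A\<close> with both indices swapped and one global minus sign. As \<open>A\<close> is non-negative, this
also makes \<open>D X D\<close> non-positive.\<close>
lemma sign_conjugate_corona_inverse:
  fixes D P :: "real mat"
  defines "D \<equiv> indexed_mat vs vs (\<lambda>u v. corona_sign u * of_bool (u = v))"
    and "P \<equiv> indexed_mat vs vs (\<lambda>u v. of_bool (u = corona_swap v))"
  shows "signature_matrix (length vs) D" and "permutation_matrix (length vs) P"
    and "D * X * D = (- 1) \<cdot>\<^sub>m (P * A * transpose_mat P)"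
    and "nonpositive_matrix (D * X * D)"
proof -
  have invol: "corona_swap (corona_swap x) = x" for x :: "'a + 'a"
    by (cases x) auto
  have swap_in: "corona_swap x \<in> set vs" if "x \<in> set vs" for x
    using that by (auto simp: vs pverts_corona_graph)
  have sign: "corona_sign x \<in> {1, - 1}" for x :: "'a + 'a"
    by (cases x) auto
  show "signature_matrix (length vs) D"
    unfolding D_def by (rule signature_matrix_indexed_mat[OF vs(1)]) (rule sign)
  have "bij_betw corona_swap (set vs) (set vs)"
    by (rule bij_betwI[where g = corona_swap]) (auto simp: invol swap_in)
  then show "permutation_matrix (length vs) P"
    unfolding P_def by (rule permutation_matrix_indexed_mat[OF vs(1)])
  have sq: "corona_sign x * corona_sign x = 1" for x :: "'a + 'a"
    by (cases x) auto
  have "corona_sign u * corona_inverse_weight G u v * corona_sign v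
      = - ((corona_sign u * corona_sign u) * (corona_sign v * corona_sign v)
          * arc_weight (corona_graph G) (corona_swap u) (corona_swap v))" for u v
    by (simp add: corona_inverse_weight_def)
  then have DXD: "D * X * D
      = indexed_mat vs vs (\<lambda>u v. - arc_weight (corona_graph G) (corona_swap u) (corona_swap v))"
    unfolding D_def X_def diagonal_conjugate_indexed_mat[OF vs(1)] by (simp add: sq)
  \<comment> \<open>As the swap is an involution, the indicator in \<open>P\<close> can be solved for its column index, over which
    the product \<open>P A P\<^sup>T\<close> sums.\<close>
  have "u = corona_swap v \<longleftrightarrow> v = corona_swap u" for u v :: "'a + 'a"
    by (metis invol)
  then have P: "P = indexed_mat vs vs (\<lambda>u v. of_bool (v = corona_swap u))"
    unfolding P_def by simp
  have "P * A * transpose_mat P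
      = indexed_mat vs vs (\<lambda>u v. arc_weight (corona_graph G) (corona_swap u) (corona_swap v))"
    unfolding P A_def transpose_indexed_mat indexed_mat_mult[OF vs(1)]
    by (rule indexed_mat_cong) (simp add: delta_simps swap_in cong: if_cong)
  then show "D * X * D = (- 1) \<cdot>\<^sub>m (P * A * transpose_mat P)"
    unfolding DXD by (intro eq_matI) (auto simp: indexed_mat_def)
  show "nonpositive_matrix (D * X * D)"
    unfolding DXD nonpositive_matrix_def by (rule ball_elements_indexed_mat) (simp add: arc_weight_def)
qed

lemma negatively_signable_corona_inverse: "negatively_signable X"
  using sign_conjugate_corona_inverse(1,4) unfolding negatively_signable_def X_def by auto

text \<open>The signature gives a vertex and its pendant the same sign, so the identity blocks keep their sign.
Each edge of \<open>G\<close> joins the two sides of the bipartition, so its entry in the block \<open>-B\<close> receives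
exactly one sign change.\<close>
lemma positively_signable_corona_inverse:
  assumes "bipartite_graph G"
  shows "positively_signable X"
proof -
  obtain Y Z where YZ: "Y \<inter> Z = {}" "parcs G \<subseteq> (Y \<times> Z) \<union> (Z \<times> Y)"
    using assms by (auto simp: bipartite_graph_def)
  define s :: "'a + 'a \<Rightarrow> real" where "s x = (if case_sum id id x \<in> Y then 1 else - 1)" for x
  let ?D = "indexed_mat vs vs (\<lambda>u v. s u * of_bool (u = v))"
  have "0 \<le> s u * corona_inverse_weight G u v * s v" if "u \<in> set vs" "v \<in> set vs" for u v
    using that YZ by - (cases u; cases v; auto simp: s_def vs pverts_corona_graph arc_weight_def)
  then have "nonnegative_matrix (?D * X * ?D)"
    unfolding X_def diagonal_conjugate_indexed_mat[OF vs(1)] nonnegative_matrix_def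
    by (rule ball_elements_indexed_mat)
  moreover have "signature_matrix (dim_row X) ?D"
    unfolding X_def dim_row_indexed_mat by (rule signature_matrix_indexed_mat[OF vs(1)]) (simp add: s_def)
  ultimately show ?thesis unfolding positively_signable_def by blast
qed

end

section \<open>The spectrum of the corona\<close>

lemma poly_char_poly:
  fixes A :: "'a :: field mat"
  assumes A: "A \<in> carrier_mat n n"
  shows "poly (char_poly A) x = det (x \<cdot>\<^sub>m 1\<^sub>m n - A)"
  unfolding char_poly_def
  by (rule poly_det_cong[of _ n]) (use A in \<open>auto simp: char_poly_matrix_def\<close>)

text \<open>Multiplying \<open>x - A\<close> from the right by \<open>(x, 0; 1, 1)\<close> clears its lower left block and leaves
\<open>x (x - B) - 1 = x ((x - 1/x) - B)\<close> in the upper left one. The determinants of block triangular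
matrices then compare the two characteristic polynomials.\<close>
lemma poly_char_poly_corona_block:
  fixes B :: "'a :: field mat"
  assumes B: "B \<in> carrier_mat n n" and x: "x \<noteq> 0"
  shows "poly (char_poly (four_block_mat B (1\<^sub>m n) (1\<^sub>m n) (0\<^sub>m n n))) x
       = x ^ n * poly (char_poly B) (x - 1 / x)"
proof -
  let ?K = "four_block_mat (x \<cdot>\<^sub>m 1\<^sub>m n - B) (- 1\<^sub>m n) (- 1\<^sub>m n) (x \<cdot>\<^sub>m 1\<^sub>m n)"
  let ?L = "four_block_mat (x \<cdot>\<^sub>m 1\<^sub>m n) (0\<^sub>m n n) (1\<^sub>m n) (1\<^sub>m n)"
  let ?S = "x \<cdot>\<^sub>m ((x - 1 / x) \<cdot>\<^sub>m 1\<^sub>m n - B)"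
  have K: "x \<cdot>\<^sub>m 1\<^sub>m (n + n) - four_block_mat B (1\<^sub>m n) (1\<^sub>m n) (0\<^sub>m n n) = ?K"
    by (rule eq_matI) (use B in auto)
  have "?K * ?L = four_block_mat
      ((x \<cdot>\<^sub>m 1\<^sub>m n - B) * (x \<cdot>\<^sub>m 1\<^sub>m n) + - 1\<^sub>m n * 1\<^sub>m n) ((x \<cdot>\<^sub>m 1\<^sub>m n - B) * 0\<^sub>m n n + - 1\<^sub>m n * 1\<^sub>m n)
      (- 1\<^sub>m n * (x \<cdot>\<^sub>m 1\<^sub>m n) + (x \<cdot>\<^sub>m 1\<^sub>m n) * 1\<^sub>m n) (- 1\<^sub>m n * 0\<^sub>m n n + (x \<cdot>\<^sub>m 1\<^sub>m n) * 1\<^sub>m n)"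
    by (rule mult_four_block_mat) (use B in auto)
  also have "\<dots> = four_block_mat ?S (- 1\<^sub>m n) (0\<^sub>m n n) (x \<cdot>\<^sub>m 1\<^sub>m n)"
  proof -
    have 1: "(x \<cdot>\<^sub>m 1\<^sub>m n - B) * (x \<cdot>\<^sub>m 1\<^sub>m n) = x \<cdot>\<^sub>m (x \<cdot>\<^sub>m 1\<^sub>m n - B)"
      using B by (subst mult_smult_distrib[where n = n]) (auto simp: minus_carrier_mat)
    have 2: "x \<cdot>\<^sub>m (x \<cdot>\<^sub>m 1\<^sub>m n - B) + - 1\<^sub>m n = ?S"
      by (rule eq_matI) (use B x in \<open>auto simp: algebra_simps\<close>)
    have 3: "- (x \<cdot>\<^sub>m 1\<^sub>m n) + x \<cdot>\<^sub>m 1\<^sub>m n = (0\<^sub>m n n :: 'a mat)"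
      by (rule eq_matI) auto
    show ?thesis using B by (simp add: 1 2 3)
  qed
  finally have KL: "?K * ?L = four_block_mat ?S (- 1\<^sub>m n) (0\<^sub>m n n) (x \<cdot>\<^sub>m 1\<^sub>m n)" .
  have "det ?K * x ^ n = det (?K * ?L)"
    using B by (subst det_mult[where n = "n + n"]) (auto simp: det_four_block_mat_upper_right_zero[OF _ refl])
  also have "\<dots> = x ^ n * det ((x - 1 / x) \<cdot>\<^sub>m 1\<^sub>m n - B) * x ^ n"
    unfolding KL using B by (subst det_four_block_mat_lower_left_zero[OF _ _ refl]) (auto simp: minus_carrier_mat)
  finally have "det ?K = x ^ n * det ((x - 1 / x) \<cdot>\<^sub>m 1\<^sub>m n - B)"
    using x by simp
  then show ?thesis
    using B by (simp add: poly_char_poly[where n = "n + n"] poly_char_poly[OF B] K)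
qed

text \<open>The usual argument for Hermitian matrices: for an eigenvector \<open>v\<close>, moving the matrix across the
product of \<open>v\<close> with its conjugate replaces the eigenvalue \<open>a\<close> by the conjugate of \<open>a\<close>.\<close>
lemma eigenvalue_of_real_symmetric_is_real:
  fixes B :: "real mat"
  assumes B: "B \<in> carrier_mat n n" and sym: "transpose_mat B = B"
    and ev: "eigenvalue (map_mat complex_of_real B) a"
  shows "a \<in> \<real>"
proof -
  let ?C = "map_mat complex_of_real B"
  from ev obtain v where v: "v \<in> carrier_vec n" "v \<noteq> 0\<^sub>v n" and eig: "?C *\<^sub>v v = a \<cdot>\<^sub>v v"
    using B by (auto simp: eigenvalue_def eigenvector_def)
  have C: "?C \<in> carrier_mat n n" using B by simp
  have cv: "conjugate v \<in> carrier_vec n" using v by simp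
  have T: "transpose_mat ?C = ?C" using sym by (simp add: map_mat_transpose)
  have "?C *\<^sub>v conjugate v = conjugate (?C *\<^sub>v v)"
    by (rule eq_vecI) (use B v in \<open>auto simp: scalar_prod_def sum_conjugate conjugate_dist_mul\<close>)
  then have eig': "?C *\<^sub>v conjugate v = conjugate a \<cdot>\<^sub>v conjugate v"
    by (simp add: eig conjugate_smult_vec)
  have "(a \<cdot>\<^sub>v v) \<bullet> conjugate v = v \<bullet> (conjugate a \<cdot>\<^sub>v conjugate v)"
    using transpose_vec_mult_scalar[OF C cv v(1)] by (simp add: T eig eig')
  then have "a * (v \<bullet>c v) = conjugate a * (v \<bullet>c v)"
    using v cv by simp
  moreover have "v \<bullet>c v \<noteq> 0" using v by simp
  ultimately have "cnj a = a" by simp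
  then show ?thesis by (simp add: Reals_cnj_iff)
qed

text \<open>The factorisation exists over the complex numbers, and as all roots are real it descends to the
real characteristic polynomial. In particular the real roots already account for all \<open>n\<close>
eigenvalues.\<close>
lemma char_poly_real_symmetric_splits:
  fixes B :: "real mat"
  assumes B: "B \<in> carrier_mat n n" and sym: "transpose_mat B = B"
  shows "char_poly B = (\<Prod>\<mu>\<in>#spectrum_mset B. [:- \<mu>, 1:])" (is ?split)
    and "size (spectrum_mset B) = n" (is ?size)
proof -
  let ?C = "map_mat complex_of_real B"
  interpret P: map_poly_inj_idom_hom complex_of_real ..
  have C: "?C \<in> carrier_mat n n" using B by simp
  from char_poly_factorized[OF C] obtain as
    where as: "char_poly ?C = (\<Prod>a\<leftarrow>as. [:- a, 1:])" "length as = n" by blast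
  have real: "a \<in> \<real>" if "a \<in> set as" for a
  proof (rule eigenvalue_of_real_symmetric_is_real[OF B sym])
    have "poly (char_poly ?C) a = 0"
      using that unfolding as by (induction as) auto
    then show "eigenvalue ?C a" using eigenvalue_root_char_poly[OF C] by blast
  qed
  define rs where "rs = map Re as"
  have "(\<Prod>a\<leftarrow>as. [:- a, 1:]) = map_poly complex_of_real (\<Prod>r\<leftarrow>rs. [:- r, 1:])"
    using real unfolding rs_def by (induction as) (auto simp: hom_distribs)
  then have "map_poly complex_of_real (char_poly B) = map_poly complex_of_real (\<Prod>r\<leftarrow>rs. [:- r, 1:])"
    using as(1) by (simp add: of_real_hom.char_poly_hom[OF B])
  then have split: "char_poly B = (\<Prod>r\<leftarrow>rs. [:- r, 1:])"
    by (rule P.injectivity)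
  have "proots (\<Prod>r\<leftarrow>rs. [:- r, 1:]) = mset rs" for rs :: "real list"
    by (induction rs) (auto simp: proots_mult prod_list_zero_iff image_iff simp del: mult_pCons_left)
  then have spec: "spectrum_mset B = mset rs"
    by (simp add: spectrum_mset_def split)
  show ?split unfolding spec split by (simp flip: prod_mset_prod_list)
  show ?size unfolding spec using as(2) by (simp add: rs_def)
qed

lemma Lambda_pow_corona_block:
  fixes B :: "real mat"
  assumes B: "B \<in> carrier_mat n n" and sym: "transpose_mat B = B"
  shows "Lambda_pow (four_block_mat B (1\<^sub>m n) (1\<^sub>m n) (0\<^sub>m n n))
       = (\<Sum>\<mu>\<in>#spectrum_mset B. sqrt (\<mu>\<^sup>2 + 4))"
proof -
  let ?A = "four_block_mat B (1\<^sub>m n) (1\<^sub>m n) (0\<^sub>m n n)"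
  let ?s = "\<lambda>\<mu> :: real. sqrt (\<mu>\<^sup>2 + 4)"
  \<comment> \<open>The polynomial \<open>x\<^sup>2 - \<mu> x - 1\<close>, written by its roots.\<close>
  define q where "q = (\<lambda>\<mu>. [:- ((\<mu> + ?s \<mu>) / 2), 1:] * [:- ((\<mu> - ?s \<mu>) / 2), 1:])"
  have q_eval: "poly (q \<mu>) x = x * ((x - 1 / x) - \<mu>)" if "x \<noteq> 0" for x \<mu>
  proof -
    have "(x - (\<mu> + ?s \<mu>) / 2) * (x - (\<mu> - ?s \<mu>) / 2) = x\<^sup>2 - \<mu> * x + (\<mu>\<^sup>2 - (?s \<mu>)\<^sup>2) / 4"
      by (simp add: field_simps power2_eq_square)
    moreover have "poly (q \<mu>) x = (x - (\<mu> + ?s \<mu>) / 2) * (x - (\<mu> - ?s \<mu>) / 2)"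
      by (simp add: q_def algebra_simps)
    ultimately have "poly (q \<mu>) x = x\<^sup>2 - \<mu> * x - 1"
      by simp
    also have "\<dots> = x * ((x - 1 / x) - \<mu>)"
      using that by (simp add: right_diff_distrib power2_eq_square)
    finally show ?thesis .
  qed
  have q_prod: "poly (\<Prod>\<mu>\<in>#M. q \<mu>) x = x ^ size M * poly (\<Prod>\<mu>\<in>#M. [:- \<mu>, 1:]) (x - 1 / x)"
    if "x \<noteq> 0" for x M
    using that by (induction M) (simp_all add: q_eval algebra_simps)
  have eval: "poly (char_poly ?A) x = poly (\<Prod>\<mu>\<in>#spectrum_mset B. q \<mu>) x" if "x \<noteq> 0" for x
    using poly_char_poly_corona_block[OF B that] q_prod[OF that, of "spectrum_mset B"]
    by (simp add: char_poly_real_symmetric_splits[OF B sym, symmetric])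
  \<comment> \<open>Two polynomials that agree everywhere except possibly at \<open>0\<close> are equal.\<close>
  have cp: "char_poly ?A = (\<Prod>\<mu>\<in>#spectrum_mset B. q \<mu>)"
  proof (rule ccontr)
    assume "char_poly ?A \<noteq> (\<Prod>\<mu>\<in>#spectrum_mset B. q \<mu>)"
    then have "finite {x. poly (char_poly ?A - (\<Prod>\<mu>\<in>#spectrum_mset B. q \<mu>)) x = 0}"
      by (intro poly_roots_finite) simp
    moreover have "- {0} \<subseteq> {x. poly (char_poly ?A - (\<Prod>\<mu>\<in>#spectrum_mset B. q \<mu>)) x = 0}"
      using eval by auto
    ultimately have "finite (- {0 :: real})" by (rule rev_finite_subset)
    then show False by (simp add: infinite_UNIV_char_0)
  qed
  have nz: "(\<Prod>\<mu>\<in>#M. q \<mu>) \<noteq> 0" for M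
    by (auto simp: q_def prod_mset_zero_iff)
  have "(\<Sum>x\<in>#proots (\<Prod>\<mu>\<in>#M. q \<mu>). \<bar>x\<bar>) = (\<Sum>\<mu>\<in>#M. ?s \<mu>)" for M
  proof (induction M)
    case (add \<mu> M)
    \<comment> \<open>The roots have opposite signs, so their absolute values add up to their distance.\<close>
    have "\<bar>\<mu>\<bar> \<le> ?s \<mu>" by (rule real_le_rsqrt) simp
    then have "0 \<le> \<mu> + ?s \<mu>" "\<mu> - ?s \<mu> \<le> 0" by linarith+
    then have "\<bar>(\<mu> + ?s \<mu>) / 2\<bar> + \<bar>(\<mu> - ?s \<mu>) / 2\<bar> = ?s \<mu>"
      by (simp add: abs_of_nonneg abs_of_nonpos field_simps)
    moreover have "proots (q \<mu>) = {#(\<mu> + ?s \<mu>) / 2, (\<mu> - ?s \<mu>) / 2#}"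
      unfolding q_def by (subst proots_mult) simp_all
    moreover have "q \<mu> \<noteq> 0" by (simp add: q_def)
    ultimately show ?case
      using add nz[of M] by (simp add: proots_mult)
  qed simp
  then show ?thesis by (simp add: Lambda_pow_def spectrum_mset_def[of ?A] cp)
qed

text \<open>Enumerating first all original vertices and then all pendant vertices in the same order produces
the block form, so the enumeration of the corona may be chosen to match the one that underlies \<open>B\<close>.\<close>
lemma corona_adjacency_similar_block:
  assumes vs: "distinct vs" "set vs = pverts (corona_graph G)"
    and us: "distinct us" "set us = pverts G"
  shows "similar_mat (indexed_mat vs vs (arc_weight (corona_graph G)))
    (four_block_mat (indexed_mat us us (arc_weight G)) (1\<^sub>m (length us)) (1\<^sub>m (length us)) (0\<^sub>m (length us) (length us)))"
proof -
  let ?ws = "map Inl us @ map Inr us" and ?a = "arc_weight (corona_graph G)"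
  have "similar_mat (indexed_mat vs vs ?a) (indexed_mat ?ws ?ws ?a)"
    using vs us by (intro similar_indexed_mat) (auto simp: distinct_map pverts_corona_graph)
  moreover have "indexed_mat us us (\<lambda>u v. ?a (Inl u) (Inr v)) = 1\<^sub>m (length us)"
    "indexed_mat us us (\<lambda>u v. ?a (Inr u) (Inl v)) = 1\<^sub>m (length us)"
    unfolding indexed_mat_eq_one[OF us(1), symmetric]
    by (rule indexed_mat_cong; simp add: us)+
  moreover have "indexed_mat us us (\<lambda>u v. ?a (Inr u) (Inr v)) = 0\<^sub>m (length us) (length us)"
    by (rule eq_matI) (auto simp: indexed_mat_def)
  ultimately show ?thesis
    by (simp add: indexed_mat_append indexed_mat_map)
qed

section \<open>The corona theorem\<close>

theorem proposition3p2:
  fixes GB :: "'a pair_pre_digraph" and GA :: "('a + 'a) pair_pre_digraph"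
    and A B :: "real mat" and m :: nat
  assumes "even m"
    and "simple_connected_graph GB"
    and "card (pverts GB) = m div 2"
    and "GA = corona_graph GB"
    and "adjacency_matrix_of GA A"
    and "adjacency_matrix_of GB B"
  shows "(signable_pseudo_invertible A \<and> negatively_integrally_invertible A) \<and>
    (bipartite_graph GB \<longrightarrow>
       signable_pseudo_invertible A \<and> positively_integrally_invertible A \<and> bipartite_graph GA) \<and>
    (Lambda_pow A = (\<Sum>\<mu>\<in>#spectrum_mset B. sqrt (\<mu>\<^sup>2 + 4)) \<and>
       (\<Sum>\<mu>\<in>#spectrum_mset B. sqrt (\<mu>\<^sup>2 + 4)) \<ge> max (Lambda_pow B) (real m)) \<and>
    homothetically_self_pseudoinvertible GA A"
proof -
  have GB: "pair_graph GB" and conn: "Digraph_Component.connected (with_proj GB)"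
    using assms(2) by (auto simp: simple_connected_graph_def)
  interpret pair_graph GB by (rule GB)
  obtain vs where vs: "distinct vs" "set vs = pverts (corona_graph GB)"
    and A: "A = indexed_mat vs vs (arc_weight (corona_graph GB))"
    using assms(4,5) by (auto elim: adjacency_matrix_ofE)
  obtain us where us: "distinct us" "set us = pverts GB" and B: "B = indexed_mat us us (arc_weight GB)"
    using assms(6) by (rule adjacency_matrix_ofE)
  define n where "n = length us"
  have m: "m = 2 * n"
    using assms(1,3) us distinct_card[of us] by (auto simp: n_def)
  let ?X = "indexed_mat vs vs (corona_inverse_weight GB)"
  note corona = finite_verts vs
  have MP: "moore_penrose_inverse A = ?X"
    unfolding A by (rule moore_penrose_inverse_corona[OF corona])
  note neg = negatively_signable_corona_inverse[OF corona]
  have signable: "signable_pseudo_invertible A"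
    unfolding signable_pseudo_invertible_def MP using neg by blast
  note inv = integral_inverse_corona[OF corona, folded A]
  have i: "negatively_integrally_invertible A"
    unfolding negatively_integrally_invertible_def using inv neg by blast
  have ii: "positively_integrally_invertible A \<and> bipartite_graph GA" if "bipartite_graph GB"
    unfolding positively_integrally_invertible_def assms(4)
    using inv positively_signable_corona_inverse[OF corona that] bipartite_corona[OF that] by blast

  have Bn: "B \<in> carrier_mat n n" and Bsym: "transpose_mat B = B"
    using adjacency_matrix_symmetric[OF GB] by (simp_all add: B n_def)
  have "char_poly A = char_poly (four_block_mat B (1\<^sub>m n) (1\<^sub>m n) (0\<^sub>m n n))"
    unfolding A B n_def by (rule char_poly_similar[OF corona_adjacency_similar_block[OF vs us]])
  then have iii: "Lambda_pow A = (\<Sum>\<mu>\<in>#spectrum_mset B. sqrt (\<mu>\<^sup>2 + 4))"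
    using Lambda_pow_corona_block[OF Bn Bsym] by (simp add: Lambda_pow_def spectrum_mset_def)
  have "\<bar>\<mu>\<bar> \<le> sqrt (\<mu>\<^sup>2 + 4)" for \<mu> :: real
    by (rule real_le_rsqrt) simp
  then have "Lambda_pow B \<le> (\<Sum>\<mu>\<in>#spectrum_mset B. sqrt (\<mu>\<^sup>2 + 4))"
    unfolding Lambda_pow_def by (intro sum_mset_mono)
  moreover have "2 \<le> sqrt (\<mu>\<^sup>2 + 4)" for \<mu> :: real
    by (rule real_le_rsqrt) simp
  then have "(\<Sum>\<mu>\<in>#spectrum_mset B. 2) \<le> (\<Sum>\<mu>\<in>#spectrum_mset B. sqrt (\<mu>\<^sup>2 + 4))"
    by (intro sum_mset_mono)
  then have "real m \<le> (\<Sum>\<mu>\<in>#spectrum_mset B. sqrt (\<mu>\<^sup>2 + 4))"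
    using char_poly_real_symmetric_splits(2)[OF Bn Bsym] by (simp add: m)
  ultimately have bound: "max (Lambda_pow B) (real m) \<le> (\<Sum>\<mu>\<in>#spectrum_mset B. sqrt (\<mu>\<^sup>2 + 4))"
    by simp

  let ?D = "indexed_mat vs vs (\<lambda>u v. corona_sign u * of_bool (u = v))"
  let ?P = "indexed_mat vs vs (\<lambda>u v. of_bool (u = corona_swap v))"
  note DP = sign_conjugate_corona_inverse[OF corona, folded A]
  have "simple_connected_graph GA"
    using pair_graph_corona[OF GB] connected_corona[OF GB conn]
    by (simp add: simple_connected_graph_def assms(4))
  moreover have "pseudo_inverse_graph A ?D (- (?D * ?X * ?D))"
    unfolding pseudo_inverse_graph_def MP using DP(1,4) by (simp add: A Let_def)
  moreover have "permutation_matrix (dim_row A) ?P"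
    using DP(2) by (simp add: A)
  ultimately have iv: "homothetically_self_pseudoinvertible GA A"
    unfolding homothetically_self_pseudoinvertible_def MP
    using assms(5) signable DP(3) by blast
  show ?thesis
    using signable i ii iii bound iv by blast
qed

end
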